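(* Let $\mathcal G$ be a finite rooted tree in which each leaf node $\ell$ has been assigned a positive value $v_\ell$. Define the values of all the other nodes $i$ of $\mathcal G$ by $$v_i^{-1}=\begin{cases} v_j^{-1}/2 & \text{if } n_i=1 \text{ and } i\to j,\\ n_i^{-1}\sum_{j:\,i\to j} v_j^{-1} & \text{if } n_i\ge2.\end{cases}$$ The optimal strategy for the Chooser in the Path Guessing Game on $\mathcal G$ is given by $$p_{i,j}=\begin{cases}1 & \text{if } n_i=1 \text{ and } i\to j,\\ v_j^{-1}\big/\sum_{k:\,i\to k}v_k^{-1} & \text{if } n_i\ge2\text{ and } i\to j,\\ 0&\text{otherwise.}\end{cases}$$ There is a one-parameter family of optimal strategies for the Guesser, given by $$q_{i,j}=\begin{cases}1 & \text{if } n_i=1\text{ and } i\to j,\\ (p_{i,j}-\beta p_{i,\min})/(1-n_i\beta p_{i,\min}) & \text{if } n_i\ge2\text{ and } i\to j,\\ 0&\text{otherwise}\end{cases}$$ and $$w_i=\begin{cases}1&\text{if } n_i=1,\\ 1-n_i\beta p_{i,\min}&\text{if } n_i\ge2,\end{cases}$$ where $p_{i,\min}=\min\{p_{i,j}: j \text{ such that } i\to j\}$, and $\beta$ is arbitrary in $[0,1]$. Under optimal play the Guesser's fortune $F$ at the end of the game satisfies $E[F]=v_0$, where $v_0$ is the value of the root node of the tree.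
   Context: Edges of the tree are directed from parent to child; $i\to j$ means that $j$ is a child of $i$, and $n_i$ is the number of children (out-degree) of $i$. Path Guessing Game on the tree: the players start at the root, both know the leaf values, and the Guesser's initial fortune is $1$. At a non-leaf node $i$, the Guesser announces a wager, expressed as a proportion $w\in[0,1]$ of her current fortune (wagers are taken to be deterministic), and secretly picks, possibly at random, a guess among the children of $i$. The Chooser, knowing the wager but not the guess, picks, possibly at random and independently of the guess, a child $j$ of $i$. The Guesser's current fortune is multiplied by $1+(n_i-1)w$ if $n_i\ge2$ and the guess was $j$; by $1+w$ if $n_i=1$ (the guess is then necessarily correct); and by $1-w$ if the guess was wrong. Both players move to $j$. If $j$ is a leaf, the Guesser's fortune is multiplied by $v_j$ and the game ends; otherwise play continues from $j$. The Guesser's goal is to maximize her expected fortune $E[F]$ at the end of the game; the Chooser's goal is to minimize it. In the claim, $p_{i,j}$ is the probability that the Chooser moves from node $i$ to node $j$, $q_{i,j}$ is the probability that the Guesser guesses $j$ when at node $i$, and $w_i$ is the proportion of her current fortune that the Guesser wagers at node $i$. *)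

theory Defs
  imports "HOL-Probability.Probability"
begin

section \<open>Finite rooted trees\<close>

definition finite_rooted_tree :: "'n set \<Rightarrow> ('n \<times> 'n) set \<Rightarrow> 'n \<Rightarrow> bool" where
  "finite_rooted_tree V E r \<longleftrightarrow>
     finite V \<and> E \<subseteq> V \<times> V \<and> r \<in> V \<and>
     (\<forall>i. (i, r) \<notin> E) \<and>
     (\<forall>j\<in>V - {r}. \<exists>!i. (i, j) \<in> E) \<and>
     (\<forall>j\<in>V. (r, j) \<in> E\<^sup>*)"

definition children :: "('n \<times> 'n) set \<Rightarrow> 'n \<Rightarrow> 'n set" where
  "children E i = {j. (i, j) \<in> E}"

definition outdeg :: "('n \<times> 'n) set \<Rightarrow> 'n \<Rightarrow> nat" where
  "outdeg E i = card (children E i)"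

definition is_leaf :: "('n \<times> 'n) set \<Rightarrow> 'n \<Rightarrow> bool" where
  "is_leaf E i \<longleftrightarrow> children E i = {}"

section \<open>The Path Guessing Game\<close>

text \<open>
  A round is a triple (wager, guess, move). A history lists the completed rounds, the most
  recent one first; all of it is known to both players.
\<close>

type_synonym 'n round = "real \<times> 'n \<times> 'n"
type_synonym 'n history = "'n round list"

fun current :: "'n \<Rightarrow> 'n history \<Rightarrow> 'n" where
  "current r [] = r"
| "current r ((w, a, b) # h) = b"

text \<open>
  Wagers depend deterministically on the history. The Chooser's move may also depend on the
  wager just announced (the second argument), but not on the current guess.
\<close>

datatype 'n guesser =
  Guesser (wager: "'n history \<Rightarrow> real") (guess_pmf: "'n history \<Rightarrow> 'n pmf")

type_synonym 'n chooser = "'n history \<Rightarrow> real \<Rightarrow> 'n pmf"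

definition guessers :: "('n \<times> 'n) set \<Rightarrow> 'n \<Rightarrow> 'n guesser set" where
  "guessers E r = {g. \<forall>h. \<not> is_leaf E (current r h) \<longrightarrow>
     wager g h \<in> {0..1} \<and> set_pmf (guess_pmf g h) \<subseteq> children E (current r h)}"

definition choosers :: "('n \<times> 'n) set \<Rightarrow> 'n \<Rightarrow> 'n chooser set" where
  "choosers E r = {c. \<forall>h. \<not> is_leaf E (current r h) \<longrightarrow>
     (\<forall>w\<in>{0..1}. set_pmf (c h w) \<subseteq> children E (current r h))}"

definition next_round ::
  "('n \<times> 'n) set \<Rightarrow> 'n \<Rightarrow> 'n guesser \<Rightarrow> 'n chooser \<Rightarrow> 'n history \<Rightarrow> 'n history pmf" where
  "next_round E r g c h =
     (if is_leaf E (current r h) then return_pmf h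
      else bind_pmf (guess_pmf g h) (\<lambda>a.
           bind_pmf (c h (wager g h)) (\<lambda>b.
           return_pmf ((wager g h, a, b) # h))))"

primrec play ::
  "('n \<times> 'n) set \<Rightarrow> 'n \<Rightarrow> 'n guesser \<Rightarrow> 'n chooser \<Rightarrow> nat \<Rightarrow> 'n history pmf" where
  "play E r g c 0 = return_pmf []"
| "play E r g c (Suc k) = bind_pmf (play E r g c k) (next_round E r g c)"

text \<open>
  Every root-to-leaf path has fewer than \<^term>\<open>card V\<close> edges and \<^const>\<open>next_round\<close> stops at
  leaves, so after \<^term>\<open>card V\<close> rounds the game has ended.
\<close>

definition outcome ::
  "'n set \<Rightarrow> ('n \<times> 'n) set \<Rightarrow> 'n \<Rightarrow> 'n guesser \<Rightarrow> 'n chooser \<Rightarrow> 'n history pmf" where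
  "outcome V E r g c = play E r g c (card V)"

fun multiplier :: "nat \<Rightarrow> 'n round \<Rightarrow> real" where
  "multiplier n (w, a, b) =
     (if n = 1 then 1 + w
      else if a = b then 1 + (real n - 1) * w
      else 1 - w)"

primrec fortune :: "('n \<times> 'n) set \<Rightarrow> 'n \<Rightarrow> 'n history \<Rightarrow> real" where
  "fortune E r [] = 1"
| "fortune E r (x # h) = fortune E r h * multiplier (outdeg E (current r h)) x"

definition final_fortune ::
  "('n \<times> 'n) set \<Rightarrow> ('n \<Rightarrow> real) \<Rightarrow> 'n \<Rightarrow> 'n history \<Rightarrow> real" where
  "final_fortune E v r h = fortune E r h * v (current r h)"

definition expected_fortune ::
  "'n set \<Rightarrow> ('n \<times> 'n) set \<Rightarrow> ('n \<Rightarrow> real) \<Rightarrow> 'n \<Rightarrow> 'n guesser \<Rightarrow> 'n chooser \<Rightarrow> real" where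
  "expected_fortune V E v r g c =
     measure_pmf.expectation (outcome V E r g c) (final_fortune E v r)"

section \<open>Optimality\<close>

text \<open>
  For positive leaf values, expected fortunes of admissible strategies are nonnegative and
  bounded, so the infimum and supremum below are genuine.
\<close>

definition optimal_guesser ::
  "'n set \<Rightarrow> ('n \<times> 'n) set \<Rightarrow> ('n \<Rightarrow> real) \<Rightarrow> 'n \<Rightarrow> 'n guesser \<Rightarrow> bool" where
  "optimal_guesser V E v r g \<longleftrightarrow> g \<in> guessers E r \<and>
     (\<forall>g'\<in>guessers E r.
        (INF c\<in>choosers E r. expected_fortune V E v r g' c)
          \<le> (INF c\<in>choosers E r. expected_fortune V E v r g c))"

definition optimal_chooser ::
  "'n set \<Rightarrow> ('n \<times> 'n) set \<Rightarrow> ('n \<Rightarrow> real) \<Rightarrow> 'n \<Rightarrow> 'n chooser \<Rightarrow> bool" where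
  "optimal_chooser V E v r c \<longleftrightarrow> c \<in> choosers E r \<and>
     (\<forall>c'\<in>choosers E r.
        (SUP g\<in>guessers E r. expected_fortune V E v r g c)
          \<le> (SUP g\<in>guessers E r. expected_fortune V E v r g c'))"

section \<open>Strategies given by node probabilities\<close>

definition chooser_given_by ::
  "('n \<times> 'n) set \<Rightarrow> 'n \<Rightarrow> ('n \<Rightarrow> 'n \<Rightarrow> real) \<Rightarrow> 'n chooser \<Rightarrow> bool" where
  "chooser_given_by E r p c \<longleftrightarrow>
     (\<forall>h. \<not> is_leaf E (current r h) \<longrightarrow>
        (\<forall>w\<in>{0..1}. \<forall>j. pmf (c h w) j = p (current r h) j))"

text \<open>
  The guessing probabilities are only prescribed where the wager is nonzero: for zero wager the
  guess is irrelevant, and the quotient in \<open>guesser_prob\<close> below is then \<open>0 / 0\<close>.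
  With a zero wager every guess distribution on the children is admitted.
\<close>

definition guesser_given_by ::
  "('n \<times> 'n) set \<Rightarrow> 'n \<Rightarrow> ('n \<Rightarrow> real) \<Rightarrow> ('n \<Rightarrow> 'n \<Rightarrow> real) \<Rightarrow> 'n guesser \<Rightarrow> bool" where
  "guesser_given_by E r w q g \<longleftrightarrow>
     g \<in> guessers E r \<and>
     (\<forall>h. \<not> is_leaf E (current r h) \<longrightarrow>
        wager g h = w (current r h) \<and>
        (w (current r h) \<noteq> 0 \<longrightarrow> (\<forall>j. pmf (guess_pmf g h) j = q (current r h) j)))"

definition chooser_prob :: "('n \<times> 'n) set \<Rightarrow> ('n \<Rightarrow> real) \<Rightarrow> 'n \<Rightarrow> 'n \<Rightarrow> real" where
  "chooser_prob E v i j =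
     (if (i, j) \<notin> E then 0
      else if outdeg E i = 1 then 1
      else inverse (v j) / (\<Sum>k\<in>children E i. inverse (v k)))"

definition min_prob :: "('n \<times> 'n) set \<Rightarrow> ('n \<Rightarrow> real) \<Rightarrow> 'n \<Rightarrow> real" where
  "min_prob E v i = Min (chooser_prob E v i ` children E i)"

definition guesser_wager :: "('n \<times> 'n) set \<Rightarrow> ('n \<Rightarrow> real) \<Rightarrow> real \<Rightarrow> 'n \<Rightarrow> real" where
  "guesser_wager E v \<beta> i =
     (if outdeg E i = 1 then 1 else 1 - real (outdeg E i) * \<beta> * min_prob E v i)"

definition guesser_prob :: "('n \<times> 'n) set \<Rightarrow> ('n \<Rightarrow> real) \<Rightarrow> real \<Rightarrow> 'n \<Rightarrow> 'n \<Rightarrow> real" where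
  "guesser_prob E v \<beta> i j =
     (if (i, j) \<notin> E then 0
      else if outdeg E i = 1 then 1
      else (chooser_prob E v i j - \<beta> * min_prob E v i)
             / (1 - real (outdeg E i) * \<beta> * min_prob E v i))"

end

theory Submission
  imports Defs
begin

text \<open>
  The potential \<open>fortune \<times> value of the current node\<close> decides everything.  Against the
  Guesser's strategies of the theorem it is a martingale whatever the Chooser does, because the
  factor expected on a move from \<open>i\<close> to \<open>j\<close> is exactly \<open>v\<^sub>i / v\<^sub>j\<close>; against the Chooser's
  strategy it is a supermartingale whatever the Guesser does.  So \<open>v\<^sub>r\<close> is the value of the game.
  If a Chooser given by \<open>p\<close> deviates from the optimal probabilities at a node reached with positive
  probability, then \<open>p\<close> exceeds them at some child of that node; staking everything on this child
  there, and playing optimally elsewhere, earns the Guesser more than \<open>v\<^sub>r\<close>.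
\<close>

section \<open>Finitely supported distributions\<close>

text \<open>Finite support reduces the total mass, an integral over the counting measure, to a
  finite sum. This turns the formulas for \<open>p\<close> and \<open>q\<close> into actual
  distributions.\<close>

lemma ex_pmf_of_weights:
  fixes f :: "'a \<Rightarrow> real"
  assumes "finite A" "\<And>x. 0 \<le> f x" "\<And>x. x \<notin> A \<Longrightarrow> f x = 0" "sum f A = 1"
  shows "\<exists>p. \<forall>x. pmf p x = f x"
proof -
  have "(\<integral>\<^sup>+x. ennreal (f x) \<partial>count_space UNIV) = (\<Sum>x\<in>A. ennreal (f x))"
    using assms by (intro nn_integral_count_space') auto
  also have "\<dots> = 1"
    using assms by (simp add: sum_ennreal)
  finally show ?thesis
    using pmf_embed_pmf[of f] assms(2) by blast
qed

lemma expectation_mono_finite: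
  fixes f g :: "'a \<Rightarrow> real"
  assumes "finite (set_pmf p)" "\<And>x. x \<in> set_pmf p \<Longrightarrow> f x \<le> g x"
  shows "measure_pmf.expectation p f \<le> measure_pmf.expectation p g"
  using assms by (intro integral_mono_AE integrable_measure_pmf_finite) (auto simp: AE_measure_pmf_iff)

text \<open>A point of the support carries positive mass, so a strict gap there survives averaging;
  one profitable history thus yields a strictly larger expectation.\<close>

lemma expectation_less_finite:
  fixes f g :: "'a \<Rightarrow> real"
  assumes fin: "finite (set_pmf p)" and le: "\<And>x. x \<in> set_pmf p \<Longrightarrow> f x \<le> g x"
    and y: "y \<in> set_pmf p" "f y < g y"
  shows "measure_pmf.expectation p f < measure_pmf.expectation p g"
proof -
  have "(\<Sum>x\<in>set_pmf p. f x * pmf p x) < (\<Sum>x\<in>set_pmf p. g x * pmf p x)"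
    using fin y le
    by (intro sum_strict_mono_ex1) (auto intro!: mult_right_mono bexI[of _ y] simp: pmf_positive)
  then show ?thesis
    using fin by (simp add: integral_measure_pmf_real[of "set_pmf p"])
qed

lemma expectation_bind_finite:
  fixes f :: "'b \<Rightarrow> real"
  assumes "finite (set_pmf p)" "\<And>x. x \<in> set_pmf p \<Longrightarrow> finite (set_pmf (k x))"
  shows "measure_pmf.expectation (bind_pmf p k) f =
    measure_pmf.expectation p (\<lambda>x. measure_pmf.expectation (k x) f)"
  using assms
  by (simp add: pmf_expectation_bind[of "set_pmf p"] integral_measure_pmf_real[of "set_pmf p"] mult.commute)

section \<open>Admissible strategies\<close>

lemma guessersD:
  assumes "g \<in> guessers E r" "\<not> is_leaf E (current r h)"
  shows "wager g h \<in> {0..1}" "set_pmf (guess_pmf g h) \<subseteq> children E (current r h)"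
  using assms by (auto simp: guessers_def)

lemma choosersD:
  assumes "c \<in> choosers E r" "\<not> is_leaf E (current r h)" "w \<in> {0..1}"
  shows "set_pmf (c h w) \<subseteq> children E (current r h)"
  using assms by (auto simp: choosers_def)

text \<open>Histories are arbitrary lists, even ones that no play produces, so conditions quantified
  over histories can be read off at any node.\<close>

lemma ex_history_at: "\<exists>h. current r h = i"
  by (rule exI[of _ "[(0, i, i)]"]) simp

text \<open>The index \<open>k\<close> counts elapsed rounds, not the length of the history: at a
  leaf the history stays the same while \<open>k\<close> grows, hence the case
  \<open>leaf\<close>.\<close>

lemma set_pmf_play_induct [consumes 3, case_names start leaf move]:
  assumes "h \<in> set_pmf (play E r g c k)" and g: "g \<in> guessers E r" and c: "c \<in> choosers E r"
    and start: "P 0 []"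
    and leaf: "\<And>k h. P k h \<Longrightarrow> P (Suc k) h"
    and move: "\<And>k h w a b. P k h \<Longrightarrow> w \<in> {0..1} \<Longrightarrow> a \<in> children E (current r h) \<Longrightarrow>
        b \<in> children E (current r h) \<Longrightarrow> P (Suc k) ((w, a, b) # h)"
  shows "P k h"
  using assms(1)
proof (induction k arbitrary: h)
  case 0
  then show ?case using start by simp
next
  case (Suc k)
  then obtain h' where h': "h' \<in> set_pmf (play E r g c k)" "h \<in> set_pmf (next_round E r g c h')"
    by auto
  show ?case
  proof (cases "is_leaf E (current r h')")
    case True
    then show ?thesis using h' Suc.IH[of h'] leaf by (simp add: next_round_def)
  next
    case False
    note G = guessersD[OF g False]
    note C = choosersD[OF c False G(1)]
    show ?thesis
      using h' False Suc.IH[of h'] G C by (auto simp: next_round_def intro!: move)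
  qed
qed

section \<open>Values and probabilities on the tree\<close>

text \<open>One function \<open>v\<close> holds both the leaf data and the values of the inner
  nodes; the recursion enters as equations rather than as a definition.\<close>

locale valued_tree =
  fixes V :: "'n set" and E :: "('n \<times> 'n) set" and r :: 'n and v :: "'n \<Rightarrow> real"
  assumes tree: "finite_rooted_tree V E r"
    and leaf_values: "\<And>i. i \<in> V \<Longrightarrow> is_leaf E i \<Longrightarrow> v i > 0"
    and value_one_child:
      "\<And>i j. outdeg E i = 1 \<Longrightarrow> (i, j) \<in> E \<Longrightarrow> inverse (v i) = inverse (v j) / 2"
    and value_many_children:
      "\<And>i. outdeg E i \<ge> 2 \<Longrightarrow>
         inverse (v i) = (\<Sum>j\<in>children E i. inverse (v j)) / real (outdeg E i)"
begin

section \<open>Tree structure: unique depths, no cycles, bounded height\<close>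

lemma finite_V: "finite V" and E_subset: "E \<subseteq> V \<times> V" and root_in_V: "r \<in> V"
  and root_no_parent: "(i, r) \<notin> E"
  and reachable: "j \<in> V \<Longrightarrow> (r, j) \<in> E\<^sup>*"
  using tree by (auto simp: finite_rooted_tree_def)

lemma parent_unique:
  assumes "(i, j) \<in> E" "(i', j) \<in> E"
  shows "i = i'"
proof -
  have "j \<in> V - {r}"
    using assms(1) E_subset root_no_parent by auto
  then show ?thesis
    using tree assms unfolding finite_rooted_tree_def by blast
qed

lemma finite_E: "finite E"
  using finite_subset[OF E_subset] finite_V by simp

lemma children_subset_V: "children E i \<subseteq> V"
  using E_subset by (auto simp: children_def)

lemma finite_children: "finite (children E i)"
  using finite_subset[OF children_subset_V finite_V] .

lemma outdeg_pos: "\<not> is_leaf E i \<Longrightarrow> outdeg E i \<ge> 1"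
  using finite_children[of i] by (simp add: is_leaf_def outdeg_def Suc_le_eq card_gt_0_iff)

text \<open>Walking up from \<open>j\<close> is forced, since parents are unique, and it stops
  exactly at the root, which has no parent. Both walks therefore lose their last edges in
  step.\<close>

lemma depth_unique: "(r, j) \<in> E ^^ m \<Longrightarrow> (r, j) \<in> E ^^ n \<Longrightarrow> m = n"
proof (induction m arbitrary: j n)
  case 0
  then show ?case using root_no_parent by (cases n) auto
next
  case (Suc m)
  then obtain i where i: "(r, i) \<in> E ^^ m" "(i, j) \<in> E"
    by auto
  with Suc.prems(2) obtain n' where n: "n = Suc n'"
    using root_no_parent by (cases n) auto
  with Suc.prems(2) obtain i' where "(r, i') \<in> E ^^ n'" "(i', j) \<in> E"
    by auto
  with i Suc.IH[of i n'] parent_unique n show ?case by blast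
qed

text \<open>A cycle through \<open>j\<close> would prolong a walk from the root to \<open>j\<close>
  and so give \<open>j\<close> two depths.\<close>

lemma acyclic_E: "acyclic E"
proof (rule acyclicI, rule allI, rule notI)
  fix j assume "(j, j) \<in> E\<^sup>+"
  then obtain k where k: "k > 0" "(j, j) \<in> E ^^ k"
    by (auto simp: trancl_power)
  have "j \<in> V"
    using \<open>(j, j) \<in> E\<^sup>+\<close> E_subset by (meson SigmaE2 subset_iff tranclE)
  then obtain n where n: "(r, j) \<in> E ^^ n"
    using reachable rtrancl_power by blast
  then have "(r, j) \<in> E ^^ (n + k)"
    using k(2) by (auto simp: relpow_add)
  with depth_unique[OF n] k(1) show False by force
qed

lemma wf_converse_E: "wf (E\<inverse>)"
  by (rule finite_acyclic_wf_converse[OF finite_E acyclic_E])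

text \<open>Some walk to \<open>j\<close> has length at most \<open>card E\<close>, and by
  uniqueness of depth that length is \<open>k\<close>. An edge is determined by its child, which is
  never the root, so there are fewer edges than nodes. Strictness leaves room for one more round
  after \<open>k\<close> of them.\<close>

lemma depth_less_card_V:
  assumes "(r, j) \<in> E ^^ k"
  shows "k < card V"
proof (cases "k = 0")
  case True
  then show ?thesis using root_in_V finite_V by (auto simp: card_gt_0_iff)
next
  case False
  with relpow_finite_bounded[OF finite_E, of k] assms
  obtain n where "n \<le> card E" "(r, j) \<in> E ^^ n"
    by auto
  moreover have "card E \<le> card (V - {r})"
    using finite_V E_subset root_no_parent parent_unique
    by (intro card_inj_on_le[of snd]) (auto simp: inj_on_def)
  ultimately show ?thesis
    using depth_unique[OF assms] finite_V root_in_V card_Diff1_less[of V r] by fastforce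
qed

lemma outdeg_le_card: "outdeg E i \<le> card V"
  unfolding outdeg_def by (rule card_mono[OF finite_V children_subset_V])

section \<open>Positive values and the recursion solved for \<open>v\<close>\<close>

lemma value_pos: "i \<in> V \<Longrightarrow> v i > 0"
\<comment> \<open>The converse of the edge relation is well-founded, so the induction climbs from
  the leaves, in the direction in which values are computed.\<close>
proof (induction i rule: wf_induct_rule[OF wf_converse_E])
  case (1 i)
  then have IH: "v j > 0" if "j \<in> children E i" for j
    using that children_subset_V by (auto simp: children_def)
  show ?case
  proof (cases "is_leaf E i")
    case True
    then show ?thesis using leaf_values 1 by simp
  next
    case False
    then have ne: "children E i \<noteq> {}" by (simp add: is_leaf_def)
    have "inverse (v i) > 0"
    proof (cases "outdeg E i = 1")
      case True
      obtain j where j: "j \<in> children E i" using ne by auto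
      then have "inverse (v i) = inverse (v j) / 2"
        using True value_one_child by (simp add: children_def)
      then show ?thesis using IH[OF j] by (metis half_gt_zero inverse_positive_iff_positive)
    next
      case n: False
      then have "outdeg E i \<ge> 2" using outdeg_pos[OF False] by simp
      moreover have "(\<Sum>j\<in>children E i. inverse (v j)) > 0"
        using finite_children ne IH by (intro sum_pos) auto
      ultimately show ?thesis using value_many_children by simp
    qed
    then show ?thesis by simp
  qed
qed

lemma value_child_pos: "j \<in> children E i \<Longrightarrow> v j > 0"
  using value_pos children_subset_V by blast

text \<open>The factor 2 is what a full wager earns on a guess that is bound to be correct.\<close>

lemma single_child:
  assumes "outdeg E i = 1" "j \<in> children E i"
  shows "children E i = {j}" "v i = 2 * v j"
proof -
  show "children E i = {j}"
    using assms unfolding outdeg_def by (metis card_1_singletonE singletonD)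
  have "inverse (v i) = inverse (v j) / 2"
    using value_one_child assms by (simp add: children_def)
  then show "v i = 2 * v j"
    by (metis inverse_divide inverse_inverse_eq divide_inverse mult.commute)
qed

section \<open>The Chooser's probabilities\<close>

lemma sum_inverse_values:
  assumes "outdeg E i \<ge> 2"
  shows "(\<Sum>k\<in>children E i. inverse (v k)) = real (outdeg E i) / v i"
  using value_many_children[OF assms] assms by (simp add: field_simps)

text \<open>The normalising sum equals \<open>n / v i\<close>. In game terms, staking everything on
  any one child earns \<open>v i\<close> on average: the Chooser makes the Guesser
  indifferent.\<close>

lemma chooser_prob_value:
  assumes "outdeg E i \<ge> 2" "j \<in> children E i"
  shows "real (outdeg E i) * chooser_prob E v i j * v j = v i"
  using assms value_child_pos[of j i] sum_inverse_values[OF assms(1)]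
  by (simp add: chooser_prob_def children_def)

lemma chooser_prob_pos:
  assumes "j \<in> children E i"
  shows "chooser_prob E v i j > 0"
proof -
  have "(\<Sum>k\<in>children E i. inverse (v k)) > 0"
    using assms finite_children value_child_pos by (intro sum_pos) auto
  then show ?thesis
    using assms value_child_pos by (simp add: chooser_prob_def children_def)
qed

lemma chooser_prob_outside: "j \<notin> children E i \<Longrightarrow> chooser_prob E v i j = 0"
  by (simp add: chooser_prob_def children_def)

lemma chooser_prob_nonneg: "chooser_prob E v i j \<ge> 0"
  using chooser_prob_pos[of j i] chooser_prob_outside[of j i] by force

lemma sum_chooser_prob:
  assumes "\<not> is_leaf E i"
  shows "sum (chooser_prob E v i) (children E i) = 1"
proof (cases "outdeg E i = 1")
  case True
  moreover obtain j where "j \<in> children E i" using assms by (auto simp: is_leaf_def)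
  ultimately show ?thesis
    using single_child(1)[of i j] by (auto simp: chooser_prob_def children_def)
next
  case False
  have "(\<Sum>k\<in>children E i. inverse (v k)) > 0"
    using assms finite_children value_child_pos by (intro sum_pos) (auto simp: is_leaf_def)
  moreover have "sum (chooser_prob E v i) (children E i) =
      (\<Sum>j\<in>children E i. inverse (v j) / (\<Sum>k\<in>children E i. inverse (v k)))"
    using False by (intro sum.cong) (auto simp: chooser_prob_def children_def)
  ultimately show ?thesis
    by (simp flip: sum_divide_distrib)
qed

section \<open>The Guesser's wagers and guessing probabilities\<close>

lemma min_prob_le: "j \<in> children E i \<Longrightarrow> min_prob E v i \<le> chooser_prob E v i j"
  unfolding min_prob_def using finite_children by (intro Min_le) auto

lemma min_prob_pos: "\<not> is_leaf E i \<Longrightarrow> min_prob E v i > 0"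
  unfolding min_prob_def is_leaf_def using finite_children chooser_prob_pos by (subst Min_gr_iff) auto

lemma outdeg_min_prob_le:
  assumes "\<not> is_leaf E i"
  shows "real (outdeg E i) * min_prob E v i \<le> 1"
  using sum_bounded_below[of "children E i" "min_prob E v i" "chooser_prob E v i"]
    min_prob_le sum_chooser_prob[OF assms] by (simp add: outdeg_def)

lemma guesser_wager_bounds:
  assumes "\<not> is_leaf E i" "\<beta> \<in> {0..1}"
  shows "guesser_wager E v \<beta> i \<in> {0..1}"
proof -
  have "\<beta> * (real (outdeg E i) * min_prob E v i) \<le> 1 * 1"
    using assms(2) outdeg_min_prob_le[OF assms(1)] min_prob_pos[OF assms(1)]
    by (intro mult_mono) auto
  then show ?thesis
    using assms min_prob_pos[OF assms(1)] by (simp add: guesser_wager_def mult_ac)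
qed

text \<open>The denominator of \<open>guesser_prob\<close> is the wager itself. The payoff involves
  only this product, the share of the fortune staked on \<open>j\<close>.\<close>

lemma guesser_wager_prob:
  assumes "outdeg E i \<ge> 2" "j \<in> children E i" "guesser_wager E v \<beta> i \<noteq> 0"
  shows "guesser_wager E v \<beta> i * guesser_prob E v \<beta> i j = chooser_prob E v i j - \<beta> * min_prob E v i"
  using assms by (simp add: guesser_wager_def guesser_prob_def children_def)

lemma guesser_prob_outside: "j \<notin> children E i \<Longrightarrow> guesser_prob E v \<beta> i j = 0"
  by (simp add: guesser_prob_def children_def)

text \<open>The bound \<open>\<beta> \<le> 1\<close> keeps the numerator nonnegative even for the
  least likely child; a vanishing denominator gives 0 by convention.\<close>

lemma guesser_prob_nonneg:
  assumes "\<beta> \<in> {0..1}"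
  shows "guesser_prob E v \<beta> i j \<ge> 0"
proof (cases "j \<in> children E i")
  case True
  then have nl: "\<not> is_leaf E i" by (auto simp: is_leaf_def)
  have "\<beta> * min_prob E v i \<le> 1 * min_prob E v i"
    using assms min_prob_pos[OF nl] by (intro mult_right_mono) auto
  then have "\<beta> * min_prob E v i \<le> chooser_prob E v i j"
    using min_prob_le[OF True] by simp
  then show ?thesis
    using guesser_wager_bounds[OF nl assms] by (auto simp: guesser_prob_def guesser_wager_def)
qed (simp add: guesser_prob_outside)

lemma sum_guesser_prob:
  assumes "\<not> is_leaf E i" "guesser_wager E v \<beta> i \<noteq> 0"
  shows "sum (guesser_prob E v \<beta> i) (children E i) = 1"
proof (cases "outdeg E i = 1")
  case True
  moreover obtain j where "j \<in> children E i" using assms by (auto simp: is_leaf_def)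
  ultimately show ?thesis
    using single_child(1)[of i j] by (auto simp: guesser_prob_def children_def)
next
  case False
  then have n: "outdeg E i \<ge> 2" using outdeg_pos[OF assms(1)] by simp
  have "guesser_wager E v \<beta> i * sum (guesser_prob E v \<beta> i) (children E i)
      = (\<Sum>j\<in>children E i. chooser_prob E v i j - \<beta> * min_prob E v i)"
    using guesser_wager_prob[OF n _ assms(2)] by (simp add: sum_distrib_left)
  also have "\<dots> = guesser_wager E v \<beta> i"
    using False sum_chooser_prob[OF assms(1)]
    by (simp add: sum_subtractf outdeg_def guesser_wager_def)
  finally show ?thesis using assms(2) by simp
qed

text \<open>Here \<open>\<beta> * (n * min_prob) = 1\<close> although neither factor exceeds 1, so
  the minimum equals the average and all the probabilities coincide. This settles the case in which
  the guess is left unprescribed.\<close>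

lemma chooser_prob_uniform:
  assumes nl: "\<not> is_leaf E i" and b: "b \<in> children E i" and \<beta>: "\<beta> \<in> {0..1}"
    and n: "outdeg E i \<ge> 2" and w: "guesser_wager E v \<beta> i = 0"
  shows "real (outdeg E i) * chooser_prob E v i b = 1"
proof -
  let ?m = "real (outdeg E i) * min_prob E v i"
  have "\<beta> * ?m = 1"
    using w n by (simp add: guesser_wager_def mult_ac)
  moreover have "\<beta> * ?m \<le> 1 * ?m"
    using \<beta> min_prob_pos[OF nl] by (intro mult_right_mono) auto
  ultimately have m: "?m = 1"
    using outdeg_min_prob_le[OF nl] by simp
  have "(\<Sum>j\<in>children E i. chooser_prob E v i j - min_prob E v i) = 0"
    using m sum_chooser_prob[OF nl] by (simp add: sum_subtractf outdeg_def)
  then have "chooser_prob E v i b = min_prob E v i"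
    using b finite_children min_prob_le by (subst (asm) sum_nonneg_eq_0_iff) auto
  then show ?thesis using m by simp
qed

section \<open>The value of a single round\<close>

text \<open>The expected potential after one round from \<open>i\<close>, per unit of fortune.
  Finite sums over the children make exchanging guess and move plain algebra.\<close>

definition round_value :: "'n \<Rightarrow> real \<Rightarrow> 'n pmf \<Rightarrow> 'n pmf \<Rightarrow> real" where
  "round_value i w Q P =
    (\<Sum>a\<in>children E i. pmf Q a * (\<Sum>b\<in>children E i. pmf P b *
       (multiplier (outdeg E i) (w, a, b) * v b)))"

text \<open>With several children, every guess keeps \<open>1 - w\<close> and a correct one gains
  \<open>n * w\<close> on top, so only the probability of guessing \<open>b\<close> matters.\<close>

lemma sum_multiplier:
  assumes b: "b \<in> children E i" and Q: "set_pmf Q \<subseteq> children E i"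
  shows "(\<Sum>a\<in>children E i. pmf Q a * multiplier (outdeg E i) (w, a, b)) =
    (if outdeg E i = 1 then 1 + w else 1 - w + real (outdeg E i) * w * pmf Q b)"
proof -
  have s: "sum (pmf Q) (children E i) = 1"
    using sum_pmf_eq_1[OF finite_children Q] .
  show ?thesis
  proof (cases "outdeg E i = 1")
    case True
    then show ?thesis using s by (simp flip: sum_distrib_right)
  next
    case False
    have "(\<Sum>a\<in>children E i. pmf Q a * multiplier (outdeg E i) (w, a, b)) =
      (\<Sum>a\<in>children E i. pmf Q a * (1 - w) + (if a = b then pmf Q b * (real (outdeg E i) * w) else 0))"
      using False by (intro sum.cong) (auto simp: algebra_simps)
    also have "\<dots> = 1 - w + real (outdeg E i) * w * pmf Q b"
      using b finite_children s by (simp add: sum.distrib flip: sum_distrib_right)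
    finally show ?thesis using False by simp
  qed
qed

lemma round_value_swap:
  "round_value i w Q P = (\<Sum>b\<in>children E i. pmf P b * (v b *
      (\<Sum>a\<in>children E i. pmf Q a * multiplier (outdeg E i) (w, a, b))))"
  unfolding round_value_def sum_distrib_left
  by (subst sum.swap) (simp add: mult_ac)

text \<open>The Guesser equalises: with several children the mean factor on a move to
  \<open>b\<close> is \<open>n * chooser_prob E v i b\<close>, with one child it is 2. Either way it
  compensates \<open>v b\<close> exactly, and \<open>P\<close> merely averages the constant
  \<open>v i\<close>.\<close>

lemma round_value_guesser:
  assumes nl: "\<not> is_leaf E i" and Q: "set_pmf Q \<subseteq> children E i" and P: "set_pmf P \<subseteq> children E i"
    and \<beta>: "\<beta> \<in> {0..1}" and w: "w = guesser_wager E v \<beta> i"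
    and q: "w \<noteq> 0 \<Longrightarrow> (\<And>j. pmf Q j = guesser_prob E v \<beta> i j)"
  shows "round_value i w Q P = v i"
proof -
  have "v b * (\<Sum>a\<in>children E i. pmf Q a * multiplier (outdeg E i) (w, a, b)) = v i"
    if b: "b \<in> children E i" for b
  proof (cases "outdeg E i = 1")
    case True
    then show ?thesis
      using single_child(2)[OF True b] unfolding sum_multiplier[OF b Q] by (simp add: w guesser_wager_def)
  next
    case False
    then have n: "outdeg E i \<ge> 2" using outdeg_pos[OF nl] by simp
    \<comment> \<open>The part \<open>n * \<beta> * min_prob\<close> held back from the wager is
      exactly what the reduced stakes lack.\<close>
    have "1 - w + real (outdeg E i) * w * pmf Q b = real (outdeg E i) * chooser_prob E v i b"
    proof (cases "w = 0")
      case False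
      have "w * pmf Q b = chooser_prob E v i b - \<beta> * min_prob E v i"
        using guesser_wager_prob[OF n b] False q w by simp
      then have "real (outdeg E i) * (w * pmf Q b)
          = real (outdeg E i) * (chooser_prob E v i b - \<beta> * min_prob E v i)"
        by (rule arg_cong)
      then have "real (outdeg E i) * w * pmf Q b
          = real (outdeg E i) * chooser_prob E v i b - real (outdeg E i) * \<beta> * min_prob E v i"
        by (simp only: right_diff_distrib mult.assoc)
      then show ?thesis
        using n by (simp add: w guesser_wager_def)
    next
      case True
      \<comment> \<open>With nothing staked the factor is 1, which is the right one because a zero
        wager occurs only for uniform probabilities.\<close>
      then have "real (outdeg E i) * chooser_prob E v i b = 1"
        using chooser_prob_uniform[OF nl b \<beta> n] w by simp
      then show ?thesis using True by simp
    qed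
    then show ?thesis
      using chooser_prob_value[OF n b] False unfolding sum_multiplier[OF b Q] by (simp add: mult_ac)
  qed
  then have "round_value i w Q P = (\<Sum>b\<in>children E i. pmf P b * v i)"
    unfolding round_value_swap by (intro sum.cong) auto
  then show ?thesis
    using sum_pmf_eq_1[OF finite_children P] by (simp flip: sum_distrib_right)
qed

text \<open>With several children each \<open>pmf P b * v b\<close> is \<open>v i / n\<close>, and
  as the guessing probabilities sum to 1 both \<open>w\<close> and \<open>Q\<close> cancel: equality
  holds. Only at a single child can the Guesser lose, by wagering less than everything.\<close>

lemma round_value_chooser:
  assumes nl: "\<not> is_leaf E i" and Q: "set_pmf Q \<subseteq> children E i" and w: "w \<in> {0..1}"
    and P: "\<And>j. pmf P j = chooser_prob E v i j"
  shows "round_value i w Q P \<le> v i"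
proof (cases "outdeg E i = 1")
  case True
  obtain b where b: "b \<in> children E i" using nl by (auto simp: is_leaf_def)
  have "round_value i w Q P = (\<Sum>b\<in>children E i. pmf P b * (v b * (1 + w)))"
    unfolding round_value_swap
  proof (rule sum.cong)
    fix b assume b: "b \<in> children E i"
    show "pmf P b * (v b * (\<Sum>a\<in>children E i. pmf Q a * multiplier (outdeg E i) (w, a, b)))
        = pmf P b * (v b * (1 + w))"
      unfolding sum_multiplier[OF b Q] using True by simp
  qed simp
  also have "\<dots> = v b * (1 + w)"
    using b P sum_chooser_prob[OF nl] single_child(1)[OF True b] by simp
  also have "\<dots> \<le> v b * 2"
    using w value_child_pos[OF b] by (intro mult_left_mono) auto
  finally show ?thesis using single_child(2)[OF True b] by simp
next
  case False
  then have n: "outdeg E i \<ge> 2" using outdeg_pos[OF nl] by simp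
  let ?n = "real (outdeg E i)"
  have "round_value i w Q P = (\<Sum>b\<in>children E i. v i / ?n * (1 - w + ?n * w * pmf Q b))"
    unfolding round_value_swap
  proof (rule sum.cong)
    fix b assume b: "b \<in> children E i"
    have "pmf P b * v b = v i / ?n"
      using chooser_prob_value[OF n b] n P by (simp add: field_simps)
    then show "pmf P b * (v b * (\<Sum>a\<in>children E i. pmf Q a * multiplier (outdeg E i) (w, a, b)))
        = v i / ?n * (1 - w + ?n * w * pmf Q b)"
      unfolding sum_multiplier[OF b Q] mult.assoc[symmetric] using False by simp
  qed simp
  also have "\<dots> = v i / ?n * (\<Sum>b\<in>children E i. 1 - w + ?n * w * pmf Q b)"
    by (simp only: sum_distrib_left)
  also have "(\<Sum>b\<in>children E i. 1 - w + ?n * w * pmf Q b) = ?n * (1 - w) + ?n * w"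
    using sum_pmf_eq_1[OF finite_children Q]
    by (simp add: sum.distrib outdeg_def flip: sum_distrib_left)
  also have "v i / ?n * (?n * (1 - w) + ?n * w) = v i / ?n * ?n"
    by (simp add: algebra_simps)
  also have "\<dots> = v i"
    using n by simp
  finally show ?thesis by simp
qed

text \<open>At full wager every move other than \<open>a\<close> ruins the Guesser, while the move
  to \<open>a\<close> multiplies her fortune by \<open>n\<close>.\<close>

lemma round_value_all_in:
  assumes n: "outdeg E i \<ge> 2" and a: "a \<in> children E i"
  shows "round_value i 1 (return_pmf a) P = real (outdeg E i) * pmf P a * v a"
proof -
  have "round_value i 1 (return_pmf a) P = (\<Sum>b\<in>children E i.
      if a = b then pmf P b * (v b * (1 + (real (outdeg E i) - 1))) else 0)"
    unfolding round_value_swap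
    using a by (intro sum.cong) (use sum_multiplier[of _ i "return_pmf a" 1] n in \<open>auto simp del: multiplier.simps\<close>)
  then show ?thesis using a finite_children by simp
qed

section \<open>Expected fortunes along a play\<close>

lemma finite_set_pmf_next_round:
  assumes g: "g \<in> guessers E r" and c: "c \<in> choosers E r"
  shows "finite (set_pmf (next_round E r g c h))"
proof (cases "is_leaf E (current r h)")
  case True
  then show ?thesis by (simp add: next_round_def)
next
  case False
  note G = guessersD[OF g False]
  note C = choosersD[OF c False G(1)]
  show ?thesis
    using False finite_subset[OF G(2) finite_children] finite_subset[OF C finite_children]
    by (simp add: next_round_def)
qed

lemma finite_set_pmf_play:
  "g \<in> guessers E r \<Longrightarrow> c \<in> choosers E r \<Longrightarrow> finite (set_pmf (play E r g c k))"
  by (induction k) (auto simp: finite_set_pmf_next_round)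

lemma expectation_play_Suc:
  fixes f :: "'n history \<Rightarrow> real"
  assumes "g \<in> guessers E r" "c \<in> choosers E r"
  shows "measure_pmf.expectation (play E r g c (Suc k)) f =
    measure_pmf.expectation (play E r g c k) (\<lambda>h. measure_pmf.expectation (next_round E r g c h) f)"
  unfolding play.simps
  by (intro expectation_bind_finite finite_set_pmf_play finite_set_pmf_next_round assms)

text \<open>The fortune so far is a common factor of all continuations, so a round reduces to the
  payoff at its node.\<close>

lemma expectation_next_round:
  assumes g: "g \<in> guessers E r" and c: "c \<in> choosers E r" and nl: "\<not> is_leaf E (current r h)"
  shows "measure_pmf.expectation (next_round E r g c h) (final_fortune E v r) =
    fortune E r h * round_value (current r h) (wager g h) (guess_pmf g h) (c h (wager g h))"
proof -
  note G = guessersD[OF g nl]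
  note C = choosersD[OF c nl G(1)]
  note fin = finite_subset[OF G(2) finite_children] finite_subset[OF C finite_children]
  show ?thesis
    using nl fin
    by (simp add: next_round_def pmf_expectation_bind[OF finite_children _ G(2)]
        pmf_expectation_bind[OF finite_children _ C] round_value_def final_fortune_def
        sum_distrib_left mult_ac del: multiplier.simps)
qed

text \<open>A round multiplies the fortune by at most 2 or the out-degree, both bounded by
  \<open>card V + 1\<close>. Nonnegativity is what later allows one-round inequalities to be
  multiplied by the fortune.\<close>

lemma fortune_bounds:
  assumes "h \<in> set_pmf (play E r g c k)" "g \<in> guessers E r" "c \<in> choosers E r"
  shows "0 \<le> fortune E r h \<and> fortune E r h \<le> (real (card V) + 1) ^ k \<and> current r h \<in> V"
  using assms
proof (induction rule: set_pmf_play_induct)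
  case start
  then show ?case by (simp add: root_in_V)
next
  case (leaf k h)
  have "(real (card V) + 1) ^ k \<le> (real (card V) + 1) ^ Suc k"
    by (intro power_increasing) auto
  then show ?case using leaf by (auto simp del: power_Suc intro: order_trans)
next
  case (move k h w a b)
  let ?n = "outdeg E (current r h)"
  have n: "?n \<ge> 1"
    using move by (intro outdeg_pos) (auto simp: is_leaf_def)
  have "(real ?n - 1) * w \<le> (real ?n - 1) * 1"
    using n move by (intro mult_left_mono) auto
  moreover have "0 \<le> (real ?n - 1) * w"
    using n move by simp
  ultimately have "0 \<le> multiplier ?n (w, a, b)" "multiplier ?n (w, a, b) \<le> real (card V) + 1"
    using n move outdeg_le_card[of "current r h"] by auto
  then have "0 \<le> fortune E r h * multiplier ?n (w, a, b)"
      "fortune E r h * multiplier ?n (w, a, b) \<le> (real (card V) + 1) ^ k * (real (card V) + 1)"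
    using move by (auto intro: mult_nonneg_nonneg mult_mono)
  then show ?case
    using move children_subset_V by (auto simp: mult_ac simp del: multiplier.simps)
qed

lemma expected_fortune_bounds:
  assumes "g \<in> guessers E r" "c \<in> choosers E r"
  shows "expected_fortune V E v r g c \<ge> 0"
    and "expected_fortune V E v r g c \<le> (real (card V) + 1) ^ card V * (\<Sum>i\<in>V. v i)"
proof -
  have b: "0 \<le> final_fortune E v r h \<and>
      final_fortune E v r h \<le> (real (card V) + 1) ^ card V * (\<Sum>i\<in>V. v i)"
    if "h \<in> set_pmf (play E r g c (card V))" for h
  proof -
    note B = fortune_bounds[OF that assms]
    have "v (current r h) \<le> (\<Sum>i\<in>V. v i)"
      using B finite_V value_pos by (intro member_le_sum) (auto intro: less_imp_le)
    then show ?thesis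
      using B value_pos[of "current r h"] unfolding final_fortune_def
      by (auto intro!: mult_nonneg_nonneg mult_mono)
  qed
  note fin = finite_set_pmf_play[OF assms, of "card V"]
  show "expected_fortune V E v r g c \<ge> 0"
    using expectation_mono_finite[OF fin, of "\<lambda>_. 0"] b by (simp add: expected_fortune_def outcome_def)
  show "expected_fortune V E v r g c \<le> (real (card V) + 1) ^ card V * (\<Sum>i\<in>V. v i)"
    using expectation_mono_finite[OF fin, of _ "\<lambda>_. (real (card V) + 1) ^ card V * (\<Sum>i\<in>V. v i)"] b
    by (simp add: expected_fortune_def outcome_def)
qed

section \<open>Optimal strategies\<close>

lemma expectation_next_round_leaf:
  "is_leaf E (current r h) \<Longrightarrow>
    measure_pmf.expectation (next_round E r g c h) (final_fortune E v r) = final_fortune E v r h"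
  by (simp add: next_round_def)

lemma guesser_given_byD:
  assumes "guesser_given_by E r (guesser_wager E v \<beta>) (guesser_prob E v \<beta>) g"
    and "\<not> is_leaf E (current r h)" "\<beta> \<in> {0..1}" "set_pmf P \<subseteq> children E (current r h)"
  shows "round_value (current r h) (wager g h) (guess_pmf g h) P = v (current r h)"
proof -
  have g: "g \<in> guessers E r" using assms(1) by (simp add: guesser_given_by_def)
  show ?thesis
    using assms
    by (intro round_value_guesser[where \<beta> = \<beta>] guessersD(2)[OF g]) (auto simp: guesser_given_by_def)
qed

text \<open>Since \<open>v\<close> is defined at inner nodes too, \<open>final_fortune\<close> is
  the potential at every stage of play. It starts at \<open>v r\<close>, and no round changes its
  expectation.\<close>

lemma expected_fortune_guesser:
  assumes gg: "guesser_given_by E r (guesser_wager E v \<beta>) (guesser_prob E v \<beta>) g"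
    and \<beta>: "\<beta> \<in> {0..1}" and c: "c \<in> choosers E r"
  shows "expected_fortune V E v r g c = v r"
proof -
  have g: "g \<in> guessers E r" using gg by (simp add: guesser_given_by_def)
  have step: "measure_pmf.expectation (next_round E r g c h) (final_fortune E v r) = final_fortune E v r h" for h
  proof (cases "is_leaf E (current r h)")
    case False
    then show ?thesis
      using expectation_next_round[OF g c False]
        guesser_given_byD[OF gg False \<beta> choosersD[OF c False guessersD(1)[OF g False]]]
      by (simp add: final_fortune_def)
  qed (rule expectation_next_round_leaf)
  have "measure_pmf.expectation (play E r g c k) (final_fortune E v r) = v r" for k
  proof (induction k)
    case (Suc k)
    then show ?case by (simp only: expectation_play_Suc[OF g c] step)
  qed (simp add: final_fortune_def)
  then show ?thesis by (simp add: expected_fortune_def outcome_def)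
qed

lemma chooser_given_by_choosers:
  assumes "chooser_given_by E r (chooser_prob E v) c"
  shows "c \<in> choosers E r"
  unfolding choosers_def
proof (intro CollectI allI impI ballI subsetI)
  fix h w x
  assume "\<not> is_leaf E (current r h)" "w \<in> {0..1}" "x \<in> set_pmf (c h w)"
  then have "chooser_prob E v (current r h) x \<noteq> 0"
    using assms by (auto simp: chooser_given_by_def set_pmf_iff)
  then show "x \<in> children E (current r h)"
    using chooser_prob_outside by blast
qed

lemma expected_fortune_chooser:
  assumes cg: "chooser_given_by E r (chooser_prob E v) c" and g: "g \<in> guessers E r"
  shows "expected_fortune V E v r g c \<le> v r"
proof -
  note c = chooser_given_by_choosers[OF cg]
  \<comment> \<open>Only histories that occur in a play are considered, because their fortune is
    known to be nonnegative.\<close>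
  have step: "measure_pmf.expectation (next_round E r g c h) (final_fortune E v r) \<le> final_fortune E v r h"
    if h: "h \<in> set_pmf (play E r g c k)" for h k
  proof (cases "is_leaf E (current r h)")
    case False
    have "round_value (current r h) (wager g h) (guess_pmf g h) (c h (wager g h)) \<le> v (current r h)"
      using cg False guessersD[OF g False]
      by (intro round_value_chooser) (auto simp: chooser_given_by_def)
    then show ?thesis
      using expectation_next_round[OF g c False] fortune_bounds[OF h g c]
      by (simp add: final_fortune_def mult_left_mono)
  qed (simp add: expectation_next_round_leaf)
  have "measure_pmf.expectation (play E r g c k) (final_fortune E v r) \<le> v r" for k
  proof (induction k)
    case (Suc k)
    have "measure_pmf.expectation (play E r g c (Suc k)) (final_fortune E v r)
        \<le> measure_pmf.expectation (play E r g c k) (final_fortune E v r)"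
      unfolding expectation_play_Suc[OF g c]
      by (intro expectation_mono_finite finite_set_pmf_play g c step)
    with Suc show ?case by linarith
  qed (simp add: final_fortune_def)
  then show ?thesis by (simp add: expected_fortune_def outcome_def)
qed

section \<open>Existence of the prescribed strategies\<close>

lemma ex_chooser: "\<exists>c. chooser_given_by E r (chooser_prob E v) c"
proof -
  have "\<exists>p. \<not> is_leaf E i \<longrightarrow> (\<forall>j. pmf p j = chooser_prob E v i j)" for i
    using ex_pmf_of_weights[OF finite_children chooser_prob_nonneg chooser_prob_outside sum_chooser_prob]
    by blast
  then obtain p where "\<And>i. \<not> is_leaf E i \<Longrightarrow> (\<forall>j. pmf (p i) j = chooser_prob E v i j)"
    by metis
  then have "chooser_given_by E r (chooser_prob E v) (\<lambda>h w. p (current r h))"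
    by (simp add: chooser_given_by_def)
  then show ?thesis by blast
qed

lemma ex_guesser:
  assumes \<beta>: "\<beta> \<in> {0..1}"
  shows "\<exists>g. guesser_given_by E r (guesser_wager E v \<beta>) (guesser_prob E v \<beta>) g"
proof -
  have "\<exists>q. \<not> is_leaf E i \<longrightarrow> set_pmf q \<subseteq> children E i \<and>
      (guesser_wager E v \<beta> i \<noteq> 0 \<longrightarrow> (\<forall>j. pmf q j = guesser_prob E v \<beta> i j))" for i
  proof (cases "is_leaf E i \<or> guesser_wager E v \<beta> i = 0")
    case True
    show ?thesis
    proof (cases "is_leaf E i")
      case False
      then obtain a where "a \<in> children E i" by (auto simp: is_leaf_def)
      \<comment> \<open>At a zero wager the formula for \<open>q\<close> is 0 everywhere and not a
        distribution, so some child is guessed outright.\<close>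
      then show ?thesis using True False by (intro exI[of _ "return_pmf a"]) auto
    qed simp
  next
    case False
    then obtain q where "\<And>j. pmf q j = guesser_prob E v \<beta> i j"
      using ex_pmf_of_weights[OF finite_children guesser_prob_nonneg[OF \<beta>] guesser_prob_outside
          sum_guesser_prob] by blast
    then show ?thesis
      by (intro exI[of _ q]) (auto simp: set_pmf_iff guesser_prob_def children_def split: if_splits)
  qed
  then obtain q where q: "\<And>i. \<not> is_leaf E i \<Longrightarrow> set_pmf (q i) \<subseteq> children E i \<and>
      (guesser_wager E v \<beta> i \<noteq> 0 \<longrightarrow> (\<forall>j. pmf (q i) j = guesser_prob E v \<beta> i j))"
    by metis
  have "guesser_given_by E r (guesser_wager E v \<beta>) (guesser_prob E v \<beta>)
      (Guesser (\<lambda>h. guesser_wager E v \<beta> (current r h)) (\<lambda>h. q (current r h)))"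
    using q guesser_wager_bounds[OF _ \<beta>] by (simp add: guesser_given_by_def guessers_def)
  then show ?thesis ..
qed

section \<open>The game value and pointwise criteria for optimality\<close>

lemma bdd_below_expected_fortune:
  "g \<in> guessers E r \<Longrightarrow> bdd_below (expected_fortune V E v r g ` choosers E r)"
  using expected_fortune_bounds(1) by (intro bdd_belowI2)

lemma bdd_above_expected_fortune:
  "c \<in> choosers E r \<Longrightarrow> bdd_above ((\<lambda>g. expected_fortune V E v r g c) ` guessers E r)"
  using expected_fortune_bounds(2) by (intro bdd_aboveI2)

lemma expected_fortune_inf_le:
  assumes "g \<in> guessers E r"
  shows "(INF c\<in>choosers E r. expected_fortune V E v r g c) \<le> v r"
proof -
  obtain c where c: "chooser_given_by E r (chooser_prob E v) c" using ex_chooser ..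
  show ?thesis
    using bdd_below_expected_fortune assms chooser_given_by_choosers[OF c] expected_fortune_chooser[OF c]
    by (intro cINF_lower2[where x = c])
qed

lemma expected_fortune_sup_ge:
  assumes "c \<in> choosers E r"
  shows "v r \<le> (SUP g\<in>guessers E r. expected_fortune V E v r g c)"
proof -
  \<comment> \<open>Any member of the family would serve; \<open>\<beta> = 0\<close> is the one that
    always stakes the whole fortune.\<close>
  obtain g where g: "guesser_given_by E r (guesser_wager E v 0) (guesser_prob E v 0) g"
    using ex_guesser[of 0] by auto
  show ?thesis
    using bdd_above_expected_fortune assms expected_fortune_guesser[OF g] g
    by (intro cSUP_upper2[where x = g]) (auto simp: guesser_given_by_def)
qed

text \<open>The best guarantee is \<open>v r\<close>: the family attains it, and the prescribed
  Chooser prevents more. An infimum comparison thus becomes a bound against each Chooser.\<close>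

lemma optimal_guesser_iff:
  "optimal_guesser V E v r g \<longleftrightarrow>
    g \<in> guessers E r \<and> (\<forall>c\<in>choosers E r. v r \<le> expected_fortune V E v r g c)"
proof
  assume opt: "optimal_guesser V E v r g"
  then have g: "g \<in> guessers E r" by (simp add: optimal_guesser_def)
  obtain g0 where g0: "guesser_given_by E r (guesser_wager E v 0) (guesser_prob E v 0) g0"
    using ex_guesser[of 0] by auto
  have "choosers E r \<noteq> {}" using ex_chooser chooser_given_by_choosers by blast
  then have "v r \<le> (INF c\<in>choosers E r. expected_fortune V E v r g0 c)"
    using expected_fortune_guesser[OF g0] by (intro cINF_greatest) auto
  also have "\<dots> \<le> (INF c\<in>choosers E r. expected_fortune V E v r g c)"
    using opt g0 by (simp add: optimal_guesser_def guesser_given_by_def)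
  finally show "g \<in> guessers E r \<and> (\<forall>c\<in>choosers E r. v r \<le> expected_fortune V E v r g c)"
    using g cINF_lower[OF bdd_below_expected_fortune[OF g]] by (meson order_trans)
next
  assume g: "g \<in> guessers E r \<and> (\<forall>c\<in>choosers E r. v r \<le> expected_fortune V E v r g c)"
  have "choosers E r \<noteq> {}" using ex_chooser chooser_given_by_choosers by blast
  then have "v r \<le> (INF c\<in>choosers E r. expected_fortune V E v r g c)"
    using g by (intro cINF_greatest) auto
  then show "optimal_guesser V E v r g"
    using g expected_fortune_inf_le by (auto simp: optimal_guesser_def intro: order_trans)
qed

text \<open>The mirror image: the prescribed Chooser attains the cap \<open>v r\<close>, and the
  Guesser's family prevents a lower one.\<close>

lemma optimal_chooser_iff:
  "optimal_chooser V E v r c \<longleftrightarrow>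
    c \<in> choosers E r \<and> (\<forall>g\<in>guessers E r. expected_fortune V E v r g c \<le> v r)"
proof
  assume opt: "optimal_chooser V E v r c"
  then have c: "c \<in> choosers E r" by (simp add: optimal_chooser_def)
  obtain c0 where c0: "chooser_given_by E r (chooser_prob E v) c0" using ex_chooser ..
  have ne: "guessers E r \<noteq> {}" using ex_guesser[of 0] by (auto simp: guesser_given_by_def)
  have "(SUP g\<in>guessers E r. expected_fortune V E v r g c)
      \<le> (SUP g\<in>guessers E r. expected_fortune V E v r g c0)"
    using opt chooser_given_by_choosers[OF c0] by (simp add: optimal_chooser_def)
  also have "\<dots> \<le> v r"
    using ne expected_fortune_chooser[OF c0] by (intro cSUP_least)
  finally show "c \<in> choosers E r \<and> (\<forall>g\<in>guessers E r. expected_fortune V E v r g c \<le> v r)"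
    using c cSUP_upper[OF _ bdd_above_expected_fortune[OF c]] by (meson order_trans)
next
  assume c: "c \<in> choosers E r \<and> (\<forall>g\<in>guessers E r. expected_fortune V E v r g c \<le> v r)"
  have "guessers E r \<noteq> {}" using ex_guesser[of 0] by (auto simp: guesser_given_by_def)
  then have "(SUP g\<in>guessers E r. expected_fortune V E v r g c) \<le> v r"
    using c by (intro cSUP_least) auto
  then show "optimal_chooser V E v r c"
    using c expected_fortune_sup_ge by (auto simp: optimal_chooser_def intro: order_trans)
qed

section \<open>Uniqueness of the optimal Chooser\<close>

lemma stationary_chooser_weights:
  assumes "chooser_given_by E r p c" "c \<in> choosers E r" "\<not> is_leaf E i"
  shows "p i j \<ge> 0" "j \<notin> children E i \<Longrightarrow> p i j = 0" "sum (p i) (children E i) = 1"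
proof -
  obtain h where h: "current r h = i" using ex_history_at by metis
  \<comment> \<open>Any admissible wager works here, as \<open>chooser_given_by\<close> prescribes
    the same law for all of them.\<close>
  have p: "pmf (c h 0) j = p i j" for j
    using assms h by (auto simp: chooser_given_by_def)
  have C: "set_pmf (c h 0) \<subseteq> children E i"
    using choosersD[OF assms(2), of h 0] assms(3) h by simp
  show "p i j \<ge> 0" "j \<notin> children E i \<Longrightarrow> p i j = 0"
    using C pmf_nonneg[of "c h 0" j] by (auto simp: p set_pmf_iff)
  show "sum (p i) (children E i) = 1"
    using sum_pmf_eq_1[OF finite_children C] by (simp add: p)
qed

section \<open>A deviation that exploits wrong probabilities\<close>

definition steps :: "('n \<Rightarrow> 'n \<Rightarrow> real) \<Rightarrow> ('n \<times> 'n) set" where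
  "steps p = {(i, j) \<in> E. p i j > 0}"

lemma steps_relpow: "(i, j) \<in> steps p ^^ k \<Longrightarrow> (i, j) \<in> E ^^ k"
  by (induction k arbitrary: j) (auto simp: steps_def)

text \<open>Only the guess at \<open>i\<close> changes. It is applied to a strategy with
  \<open>\<beta> = 0\<close>, whose wager is already full, so everything is staked on
  \<open>a\<close> there.\<close>

definition deviation :: "'n guesser \<Rightarrow> 'n \<Rightarrow> 'n \<Rightarrow> 'n guesser" where
  "deviation g i a =
    Guesser (wager g) (\<lambda>h. if current r h = i then return_pmf a else guess_pmf g h)"

context
  fixes g i a
  assumes gg: "guesser_given_by E r (guesser_wager E v 0) (guesser_prob E v 0) g"
    and a: "a \<in> children E i" and n: "outdeg E i \<ge> 2"
begin

lemma deviation_guessers: "deviation g i a \<in> guessers E r"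
  using gg a by (auto simp: deviation_def guesser_given_by_def guessers_def)

lemma wager_deviation: "\<not> is_leaf E (current r h) \<Longrightarrow> wager (deviation g i a) h = 1"
  using gg by (simp add: deviation_def guesser_given_by_def guesser_wager_def)

text \<open>For \<open>\<beta> = 0\<close> the Guesser guesses with the Chooser's optimal
  probabilities, all positive; this is why she can arrive at \<open>i\<close> with her fortune
  intact.\<close>

lemma guess_deviation:
  assumes "current r h \<noteq> i" "j \<in> children E (current r h)"
  shows "pmf (guess_pmf (deviation g i a) h) j > 0"
proof -
  have "\<not> is_leaf E (current r h)" using assms(2) by (auto simp: is_leaf_def)
  then have "pmf (guess_pmf (deviation g i a) h) j = guesser_prob E v 0 (current r h) j"
    using gg assms by (simp add: deviation_def guesser_given_by_def guesser_wager_def)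
  also have "\<dots> = chooser_prob E v (current r h) j"
    by (simp add: guesser_prob_def chooser_prob_def)
  finally show ?thesis using chooser_prob_pos[OF assms(2)] by simp
qed

context
  fixes p c
  assumes cp: "chooser_given_by E r p c" and c: "c \<in> choosers E r"
    and better: "p i a > chooser_prob E v i a"
begin

text \<open>At full wager a wrong guess is ruinous, so the history is built with every guess equal
  to the move.\<close>

lemma reach_deviation:
  assumes "(r, i) \<in> E ^^ k" "(r, x) \<in> steps p ^^ m" "m \<le> k"
  shows "\<exists>h\<in>set_pmf (play E r (deviation g i a) c m). current r h = x \<and> fortune E r h > 0"
  using assms(2,3)
proof (induction m arbitrary: x)
  case 0
  then show ?case by simp
next
  case (Suc m)
  then obtain y where y: "(r, y) \<in> steps p ^^ m" "(y, x) \<in> E" "p y x > 0"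
    by (auto simp: steps_def)
  with Suc obtain h where h: "h \<in> set_pmf (play E r (deviation g i a) c m)"
      "current r h = y" "fortune E r h > 0"
    by auto
  have "(r, y) \<in> E ^^ m"
    using y(1) by (rule steps_relpow)
  \<comment> \<open>The depth \<open>m\<close> of \<open>y\<close> is less than the depth
    \<open>k\<close> of \<open>i\<close>, so the altered guess is not met on the way.\<close>
  then have "y \<noteq> i"
    using depth_unique[OF assms(1)] Suc.prems(2) by auto
  have x: "x \<in> children E (current r h)" using h y by (simp add: children_def)
  then have nl: "\<not> is_leaf E (current r h)" by (auto simp: is_leaf_def)
  have "x \<in> set_pmf (guess_pmf (deviation g i a) h)"
    using guess_deviation[OF _ x] h \<open>y \<noteq> i\<close> by (auto simp: set_pmf_iff)
  moreover have "x \<in> set_pmf (c h 1)"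
    using cp nl h y by (auto simp: chooser_given_by_def set_pmf_iff)
  ultimately have "(1, x, x) # h \<in> set_pmf (next_round E r (deviation g i a) c h)"
    using nl wager_deviation[OF nl] by (auto simp: next_round_def)
  moreover have "fortune E r ((1, x, x) # h) > 0"
    using h outdeg_pos[OF nl] by simp
  ultimately show ?case using h by (intro bexI[of _ "(1, x, x) # h"]) auto
qed

text \<open>Away from \<open>i\<close> the round is still the equalising one. At \<open>i\<close>
  the stake earns \<open>n * p i a * v a\<close>, and with the optimal probability in place of
  \<open>p i a\<close> this would be \<open>v i\<close>.\<close>

lemma deviation_round_value:
  assumes nl: "\<not> is_leaf E (current r h)"
  shows "v (current r h) \<le> round_value (current r h) (wager (deviation g i a) h)
      (guess_pmf (deviation g i a) h) (c h (wager (deviation g i a) h))"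
    and "current r h = i \<Longrightarrow> v (current r h) < round_value (current r h) (wager (deviation g i a) h)
      (guess_pmf (deviation g i a) h) (c h (wager (deviation g i a) h))"
proof -
  show less: "v (current r h) < round_value (current r h) (wager (deviation g i a) h)
      (guess_pmf (deviation g i a) h) (c h (wager (deviation g i a) h))" if h: "current r h = i"
  proof -
    have "v i = real (outdeg E i) * v a * chooser_prob E v i a"
      using chooser_prob_value[OF n a] by (simp add: mult_ac)
    also have "\<dots> < real (outdeg E i) * v a * p i a"
      using better n value_child_pos[OF a] by (intro mult_strict_left_mono) auto
    also have "\<dots> = round_value i 1 (return_pmf a) (c h 1)"
      using cp nl h by (simp add: round_value_all_in[OF n a] chooser_given_by_def)
    finally show ?thesis
      using h wager_deviation[OF nl] by (simp add: deviation_def)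
  qed
  show "v (current r h) \<le> round_value (current r h) (wager (deviation g i a) h)
      (guess_pmf (deviation g i a) h) (c h (wager (deviation g i a) h))"
  proof (cases "current r h = i")
    case False
    have g: "g \<in> guessers E r" using gg by (simp add: guesser_given_by_def)
    have "round_value (current r h) (wager g h) (guess_pmf g h) (c h (wager g h)) = v (current r h)"
      using choosersD[OF c nl guessersD(1)[OF g nl]] by (intro guesser_given_byD[OF gg nl]) auto
    then show ?thesis using False by (simp add: deviation_def)
  qed (use less in simp)
qed

text \<open>The potential never falls in expectation, and it strictly rises in the round played at
  depth \<open>k\<close>, where \<open>i\<close> is visited with positive probability and positive
  fortune.\<close>

lemma deviation_wins:
  assumes reach: "(r, i) \<in> (steps p)\<^sup>*"
  shows "expected_fortune V E v r (deviation g i a) c > v r"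
proof -
  let ?g = "deviation g i a"
  let ?F = "\<lambda>k. measure_pmf.expectation (play E r ?g c k) (final_fortune E v r)"
  let ?N = "\<lambda>h. measure_pmf.expectation (next_round E r ?g c h) (final_fortune E v r)"
  note dg = deviation_guessers
  have step: "final_fortune E v r h \<le> ?N h" if h: "h \<in> set_pmf (play E r ?g c k)" for h k
  proof (cases "is_leaf E (current r h)")
    case False
    then show ?thesis
      using expectation_next_round[OF dg c False] fortune_bounds[OF h dg c] deviation_round_value(1)[OF False]
      by (simp add: final_fortune_def mult_left_mono)
  qed (simp add: expectation_next_round_leaf)
  have "?F k \<le> ?F (Suc k)" for k
    unfolding expectation_play_Suc[OF dg c]
    by (intro expectation_mono_finite finite_set_pmf_play dg c step)
  then have mono: "mono ?F" by (rule incseq_SucI)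
  obtain k where k: "(r, i) \<in> steps p ^^ k" using reach rtrancl_power by blast
  have kE: "(r, i) \<in> E ^^ k"
    using k by (rule steps_relpow)
  obtain h where h: "h \<in> set_pmf (play E r ?g c k)" "current r h = i" "fortune E r h > 0"
    using reach_deviation[OF kE k] by auto
  have nl: "\<not> is_leaf E (current r h)" using h a by (auto simp: is_leaf_def)
  have "final_fortune E v r h < ?N h"
    using expectation_next_round[OF dg c nl] h deviation_round_value(2)[OF nl]
    by (simp add: final_fortune_def)
  then have "?F k < ?F (Suc k)"
    unfolding expectation_play_Suc[OF dg c]
    by (intro expectation_less_finite[of _ _ _ h] finite_set_pmf_play dg c step h)
  \<comment> \<open>The strict round counts because \<open>Suc k \<le> card V\<close>.\<close>
  moreover have "?F 0 \<le> ?F k" "?F (Suc k) \<le> ?F (card V)"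
    using monoD[OF mono, of 0 k] monoD[OF mono, of "Suc k" "card V"] depth_less_card_V[OF kE]
    by simp_all
  moreover have "?F 0 = v r" by (simp add: final_fortune_def)
  ultimately show ?thesis by (simp add: expected_fortune_def outcome_def)
qed

end

end

text \<open>Two distributions on the same children agree once one is dominated by the other, so it
  suffices to exclude an excess at a child \<open>a\<close>. With one child there is no freedom;
  otherwise \<open>deviation_wins\<close> contradicts optimality.\<close>

lemma optimal_chooser_prob_at:
  assumes cp: "chooser_given_by E r p c" and opt: "optimal_chooser V E v r c"
    and reach: "(r, i) \<in> (steps p)\<^sup>*" and nl: "\<not> is_leaf E i"
  shows "p i j = chooser_prob E v i j"
proof -
  have c: "c \<in> choosers E r" using opt by (simp add: optimal_chooser_def)
  note w = stationary_chooser_weights[OF cp c nl]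
  have le: "p i a \<le> chooser_prob E v i a" if a: "a \<in> children E i" for a
  proof (rule ccontr)
    assume "\<not> p i a \<le> chooser_prob E v i a"
    then have better: "chooser_prob E v i a < p i a" by simp
    have "outdeg E i \<noteq> 1"
    proof
      assume "outdeg E i = 1"
      then have "children E i = {a}" using single_child(1) a by blast
      then show False using better w(3) sum_chooser_prob[OF nl] by simp
    qed
    then have n: "outdeg E i \<ge> 2" using outdeg_pos[OF nl] by simp
    obtain g where g: "guesser_given_by E r (guesser_wager E v 0) (guesser_prob E v 0) g"
      using ex_guesser[of 0] by auto
    show False
      using deviation_wins[OF g a n cp c better reach] deviation_guessers[OF g a n]
        opt optimal_chooser_iff by force
  qed
  have "(\<Sum>a\<in>children E i. chooser_prob E v i a - p i a) = 0"
    using w(3) sum_chooser_prob[OF nl] by (simp add: sum_subtractf)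
  then have "p i a = chooser_prob E v i a" if "a \<in> children E i" for a
    using that le finite_children by (subst (asm) sum_nonneg_eq_0_iff) auto
  then show ?thesis
    using w(2) chooser_prob_outside by (cases "j \<in> children E i") auto
qed

text \<open>At a node that is reached the probabilities are forced to be the optimal ones, which are
  positive on all children, so every child is reached as well.\<close>

lemma optimal_chooser_reach:
  assumes cp: "chooser_given_by E r p c" and opt: "optimal_chooser V E v r c"
    and "(r, i) \<in> E\<^sup>*"
  shows "(r, i) \<in> (steps p)\<^sup>*"
  using assms(3)
proof (induction rule: rtrancl_induct)
  case (step y z)
  then have z: "z \<in> children E y" by (simp add: children_def)
  then have "p y z = chooser_prob E v y z"
    using optimal_chooser_prob_at[OF cp opt step.IH] by (auto simp: is_leaf_def)
  then have "(y, z) \<in> steps p"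
    using chooser_prob_pos[OF z] step by (simp add: steps_def)
  with step.IH show ?case by (rule rtrancl.rtrancl_into_rtrancl)
qed simp

end

theorem theorem2:
  fixes V :: "'n set" and E :: "('n \<times> 'n) set" and r :: 'n and v :: "'n \<Rightarrow> real"
  assumes tree: "finite_rooted_tree V E r"
    and leaf_values: "\<And>i. i \<in> V \<Longrightarrow> is_leaf E i \<Longrightarrow> v i > 0"
    and value_one_child:
      "\<And>i j. outdeg E i = 1 \<Longrightarrow> (i, j) \<in> E \<Longrightarrow> inverse (v i) = inverse (v j) / 2"
    and value_many_children:
      "\<And>i. outdeg E i \<ge> 2 \<Longrightarrow>
         inverse (v i) = (\<Sum>j\<in>children E i. inverse (v j)) / real (outdeg E i)"
  shows
    "((\<exists>c. chooser_given_by E r (chooser_prob E v) c) \<and>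
      (\<forall>c. chooser_given_by E r (chooser_prob E v) c \<longrightarrow> optimal_chooser V E v r c) \<and>
      (\<forall>p c. chooser_given_by E r p c \<and> optimal_chooser V E v r c \<longrightarrow>
         (\<forall>i\<in>V. \<not> is_leaf E i \<longrightarrow> (\<forall>j. p i j = chooser_prob E v i j)))) \<and>
     (\<forall>\<beta>\<in>{0..1}.
        (\<exists>g. guesser_given_by E r (guesser_wager E v \<beta>) (guesser_prob E v \<beta>) g) \<and>
        (\<forall>g. guesser_given_by E r (guesser_wager E v \<beta>) (guesser_prob E v \<beta>) g \<longrightarrow>
           optimal_guesser V E v r g)) \<and>
     (\<forall>g c. optimal_guesser V E v r g \<and> optimal_chooser V E v r c \<longrightarrow>
        expected_fortune V E v r g c = v r)"
proof -
  interpret valued_tree V E r v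
    using assms by unfold_locales
  have "optimal_chooser V E v r c" if "chooser_given_by E r (chooser_prob E v) c" for c
    using that chooser_given_by_choosers expected_fortune_chooser by (simp add: optimal_chooser_iff)
  moreover have "p i j = chooser_prob E v i j"
    if "chooser_given_by E r p c" "optimal_chooser V E v r c" "i \<in> V" "\<not> is_leaf E i" for p c i j
    using optimal_chooser_prob_at[OF that(1,2) optimal_chooser_reach[OF that(1,2) reachable] that(4)] that(3)
    by blast
  moreover have "optimal_guesser V E v r g"
    if "\<beta> \<in> {0..1}" "guesser_given_by E r (guesser_wager E v \<beta>) (guesser_prob E v \<beta>) g" for \<beta> g
    using that expected_fortune_guesser[OF that(2,1)]
    unfolding optimal_guesser_iff guesser_given_by_def by simp
  \<comment> \<open>The two criteria bound the same expectation by \<open>v r\<close> from below and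
    above, for every optimal pair and not just for strategies given by the formulas.\<close>
  moreover have "expected_fortune V E v r g c = v r"
    if "optimal_guesser V E v r g" "optimal_chooser V E v r c" for g c
    using that by (auto simp: optimal_guesser_iff optimal_chooser_iff intro: antisym)
  ultimately show ?thesis
    using ex_chooser ex_guesser by blast
qed

end
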